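(* Let $G_1$ and $G_2$ be connected graphs with $\gamma(G_1)\le \gamma(G_2)$. Then $\gamma(G_1\vee G_2)=1$ if $\gamma(G_1)=1$, and $\gamma(G_1\vee G_2)=2$ if $\gamma(G_1)\ge 2$. Moreover: (a) if $\gamma(G_1)=\gamma(G_2)=1$, then $\zeta(G_1\vee G_2)=\zeta(G_1)+\zeta(G_2)$; (b) if $\gamma(G_1)=\gamma(G_2)=2$, then $\zeta(G_1\vee G_2)=\zeta(G_1)+\zeta(G_2)+|V(G_1)|\cdot|V(G_2)|$; (c) if $\gamma(G_1)=1<\gamma(G_2)$, then $\zeta(G_1\vee G_2)=\zeta(G_1)$; (d) if $\gamma(G_1)=2<\gamma(G_2)$, then $\zeta(G_1\vee G_2)=\zeta(G_1)+|V(G_1)|\cdot|V(G_2)|$; (e) if $2<\gamma(G_1)\le\gamma(G_2)$, then $\zeta(G_1\vee G_2)=|V(G_1)|\cdot|V(G_2)|$.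
   Context: All graphs are finite and simple. For a graph $G=(V,E)$, a set $S\subseteq V$ is a dominating set if every vertex of $V\setminus S$ is adjacent to some vertex of $S$. The domination number $\gamma(G)$ is the minimum cardinality of a dominating set; a dominating set of cardinality $\gamma(G)$ is called a $\gamma$-set. The dominion $\zeta(G)$ is the number of $\gamma$-sets of $G$. The join $G_1\vee G_2$ is the graph obtained from the disjoint union of $G_1$ and $G_2$ by adding all edges between $V(G_1)$ and $V(G_2)$. *)

theory Defs
  imports "Graph_Theory.Digraph_Component"
begin

text \<open>
  A finite simple graph is a \<^locale>\<open>pair_graph\<close>: finite vertex set, symmetric and irreflexive
  set of ordered pairs as adjacency relation. The library's \<^const>\<open>connected\<close> excludes the
  graph without vertices.
\<close>

definition dominating_set :: "'a pair_pre_digraph \<Rightarrow> 'a set \<Rightarrow> bool" where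
  "dominating_set G S \<longleftrightarrow>
     S \<subseteq> pverts G \<and> (\<forall>v \<in> pverts G - S. \<exists>u \<in> S. (v, u) \<in> parcs G)"

definition domination_number :: "'a pair_pre_digraph \<Rightarrow> nat" where
  "domination_number G = Min (card ` {S. dominating_set G S})"

definition gamma_set :: "'a pair_pre_digraph \<Rightarrow> 'a set \<Rightarrow> bool" where
  "gamma_set G S \<longleftrightarrow> dominating_set G S \<and> card S = domination_number G"

definition dominion :: "'a pair_pre_digraph \<Rightarrow> nat" where
  "dominion G = card {S. gamma_set G S}"

text \<open>
  The disjoint union of the two vertex sets is formed in the sum type, so no disjointness
  assumption is needed. Every edge between the two sides occurs in both directions.
\<close>

definition graph_join ::
  "'a pair_pre_digraph \<Rightarrow> 'b pair_pre_digraph \<Rightarrow> ('a + 'b) pair_pre_digraph" where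
  "graph_join G H =
     \<lparr> pverts = pverts G <+> pverts H,
       parcs = map_prod Inl Inl ` parcs G \<union> map_prod Inr Inr ` parcs H
         \<union> (Inl ` pverts G) \<times> (Inr ` pverts H) \<union> (Inr ` pverts H) \<times> (Inl ` pverts G) \<rparr>"

lemma pair_graph_graph_join:
  assumes "pair_graph G" "pair_graph H"
  shows "pair_graph (graph_join G H)"
proof -
  interpret G: pair_graph G by fact
  interpret H: pair_graph H by fact
  show ?thesis
  proof
    show "symmetric (with_proj (graph_join G H))"
      using G.sym_arcs H.sym_arcs
      by (auto simp: graph_join_def symmetric_def sym_def)
  qed (auto simp: graph_join_def G.in_arcsD1 G.in_arcsD2 H.in_arcsD1 H.in_arcsD2
        dest: G.pair_no_loops H.pair_no_loops)
qed

end

theory Submission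
  imports Defs
begin

text \<open>
  In a join of nonempty graphs, a set meeting both sides dominates, and a set contained in one side
  dominates exactly when it dominates that side. So dominating sets of cardinality \<open>n \<le> 2\<close> of the join
  are those of either graph, plus, for \<open>n = 2\<close>, the pairs with one vertex on each side. The domination
  number is the least \<open>n\<close> for which this count is nonzero, and the dominion is its value there.
\<close>

definition dominating_count :: "'a pair_pre_digraph \<Rightarrow> nat \<Rightarrow> nat" where
  "dominating_count G n = card {S. dominating_set G S \<and> card S = n}"

lemma finite_dominating_sets:
  assumes "finite (pverts G)"
  shows "finite {S. dominating_set G S \<and> P S}"
  by (rule finite_subset[of _ "Pow (pverts G)"]) (auto simp: dominating_set_def assms)

lemma dominion_eq_dominating_count: "dominion G = dominating_count G (domination_number G)"
  by (simp add: dominion_def gamma_set_def dominating_count_def)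

text \<open>Finiteness matters because \<open>card\<close> is 0 on an infinite family: with finitely
  many vertices there are finitely many candidate sets, so a single witness makes the count
  positive.\<close>

lemma dominating_count_pos_iff:
  assumes "finite (pverts G)"
  shows "dominating_count G n > 0 \<longleftrightarrow> (\<exists>S. dominating_set G S \<and> card S = n)"
  using finite_dominating_sets[OF assms, of "\<lambda>S. card S = n"]
  by (auto simp: dominating_count_def card_gt_0_iff)

text \<open>The sizes of dominating sets are exactly the \<open>n\<close> with positive count.
  Replacing \<open>Min\<close> by \<open>LEAST\<close> reduces every later claim about the
  domination number to values of \<open>dominating_count\<close>.\<close>

lemma domination_number_eq_Least:
  assumes "finite (pverts G)"
  shows "domination_number G = (LEAST n. dominating_count G n > 0)"
proof -
  let ?K = "card ` {S. dominating_set G S}"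
  have "finite ?K"
    using finite_dominating_sets[OF assms, of "\<lambda>_. True"] by simp
  moreover have "pverts G \<in> {S. dominating_set G S}"
    by (simp add: dominating_set_def)
  then have "?K \<noteq> {}"
    by blast
  ultimately have "Min ?K = (LEAST n. n \<in> ?K)"
    by (intro Least_equality[symmetric] Min_in Min_le)
  also have "(\<lambda>n. n \<in> ?K) = (\<lambda>n. dominating_count G n > 0)"
    by (auto simp: dominating_count_pos_iff[OF assms])
  finally show ?thesis
    by (simp add: domination_number_def)
qed

lemma dominating_count_domination_number_pos:
  assumes "finite (pverts G)"
  shows "dominating_count G (domination_number G) > 0"
proof -
  have "dominating_set G (pverts G)"
    by (simp add: dominating_set_def)
  then have "dominating_count G (card (pverts G)) > 0"
    using dominating_count_pos_iff[OF assms] by blast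
  then show ?thesis
    unfolding domination_number_eq_Least[OF assms] by (rule LeastI)
qed

lemma dominating_count_eq_0:
  assumes "finite (pverts G)" and "n < domination_number G"
  shows "dominating_count G n = 0"
  using assms not_less_Least[of n "\<lambda>n. dominating_count G n > 0"]
  by (simp add: domination_number_eq_Least)

lemma domination_number_eqI:
  assumes "finite (pverts G)" and "dominating_count G n > 0"
    and "\<And>m. m < n \<Longrightarrow> dominating_count G m = 0"
  shows "domination_number G = n"
  unfolding domination_number_eq_Least[OF assms(1)]
  using assms(2,3) by (intro Least_equality) (auto intro: leI)

lemma dominating_set_nonempty:
  assumes "dominating_set G S" and "pverts G \<noteq> {}"
  shows "S \<noteq> {}"
  using assms by (auto simp: dominating_set_def)

text \<open>A finite set of size 0 is empty and dominates no vertex. For the join this leaves sizes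
  1 and 2 to be examined.\<close>

lemma dominating_count_0:
  assumes "finite (pverts G)" and "pverts G \<noteq> {}"
  shows "dominating_count G 0 = 0"
proof -
  have "card S \<noteq> 0" if "dominating_set G S" for S
    using that assms dominating_set_nonempty[OF that]
    by (auto simp: dominating_set_def dest: finite_subset)
  then show ?thesis
    unfolding dominating_count_def by (metis (mono_tags, lifting) card.empty empty_Collect_eq)
qed

text \<open>The preimages under \<open>Inl\<close> and \<open>Inr\<close> recover both summands.
  This uniqueness gives injectivity and disjointness when the dominating sets of the join are
  counted.\<close>

lemma Plus_eq_iff: "A <+> B = A' <+> B' \<longleftrightarrow> A = A' \<and> B = B'"
proof
  assume "A <+> B = A' <+> B'"
  moreover have "Inl -` (C <+> D) = C" "Inr -` (C <+> D) = D" for C D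
    by auto
  ultimately show "A = A' \<and> B = B'"
    by metis
qed simp

lemma pverts_graph_join [simp]: "pverts (graph_join G H) = pverts G <+> pverts H"
  by (simp add: graph_join_def)

lemma parcs_graph_join_iff [simp]:
  "(Inl a, Inl a') \<in> parcs (graph_join G H) \<longleftrightarrow> (a, a') \<in> parcs G"
  "(Inr b, Inr b') \<in> parcs (graph_join G H) \<longleftrightarrow> (b, b') \<in> parcs H"
  "(Inl a, Inr b) \<in> parcs (graph_join G H) \<longleftrightarrow> a \<in> pverts G \<and> b \<in> pverts H"
  "(Inr b, Inl a) \<in> parcs (graph_join G H) \<longleftrightarrow> a \<in> pverts G \<and> b \<in> pverts H"
  by (force simp: graph_join_def)+

lemma dominating_set_graph_join_iff:
  assumes "pverts G \<noteq> {}" and "pverts H \<noteq> {}"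
  shows "dominating_set (graph_join G H) (A <+> B) \<longleftrightarrow>
    dominating_set G A \<and> B = {} \<or> A = {} \<and> dominating_set H B \<or>
    A \<noteq> {} \<and> B \<noteq> {} \<and> A \<subseteq> pverts G \<and> B \<subseteq> pverts H"
proof -
  \<comment> \<open>A vertex of \<open>G\<close> is adjacent to every vertex of \<open>H\<close>, so
    any element of \<open>B\<close> dominates it; the cross edges therefore contribute just
    \<open>B \<noteq> {}\<close>, and symmetrically \<open>A \<noteq> {}\<close>.\<close>
  have "dominating_set (graph_join G H) (A <+> B) \<longleftrightarrow>
      A \<subseteq> pverts G \<and> B \<subseteq> pverts H \<and>
      (\<forall>v \<in> pverts G - A. (\<exists>u \<in> A. (v, u) \<in> parcs G) \<or> B \<noteq> {}) \<and>
      (\<forall>v \<in> pverts H - B. (\<exists>u \<in> B. (v, u) \<in> parcs H) \<or> A \<noteq> {})"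
  proof -
    have "A <+> B \<subseteq> pverts G <+> pverts H \<longleftrightarrow> A \<subseteq> pverts G \<and> B \<subseteq> pverts H"
      by auto
    moreover have "pverts G <+> pverts H - (A <+> B) = (pverts G - A) <+> (pverts H - B)"
      by auto
    moreover have "(\<forall>v \<in> C <+> D. P v) \<longleftrightarrow> (\<forall>a \<in> C. P (Inl a)) \<and> (\<forall>b \<in> D. P (Inr b))"
      and "(\<exists>v \<in> C <+> D. P v) \<longleftrightarrow> (\<exists>a \<in> C. P (Inl a)) \<or> (\<exists>b \<in> D. P (Inr b))"
      for C :: "'a set" and D :: "'b set" and P
      by (auto simp: Plus_def)
    ultimately show ?thesis
      unfolding dominating_set_def pverts_graph_join by simp blast
  qed
  \<comment> \<open>If \<open>B\<close> is empty, \<open>A\<close> must dominate \<open>G\<close>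
    and be nonempty in order to reach \<open>H\<close>; the latter follows from the former because
    \<open>G\<close> has vertices.\<close>
  then show ?thesis
    using assms by (auto simp: dominating_set_def)
qed

lemma dominating_sets_graph_join:
  assumes "finite (pverts G)" "finite (pverts H)" "pverts G \<noteq> {}" "pverts H \<noteq> {}"
  shows "{S. dominating_set (graph_join G H) S \<and> card S = n} =
    (\<lambda>A. A <+> {}) ` {A. dominating_set G A \<and> card A = n} \<union>
    (\<lambda>B. {} <+> B) ` {B. dominating_set H B \<and> card B = n} \<union>
    (\<lambda>(A, B). A <+> B) `
      {(A, B). A \<noteq> {} \<and> B \<noteq> {} \<and> A \<subseteq> pverts G \<and> B \<subseteq> pverts H \<and> card A + card B = n}"
    (is "?L = ?R")
proof -
  \<comment> \<open>Domination places \<open>A\<close> and \<open>B\<close> inside the finite vertex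
    sets, as \<open>card_Plus\<close> requires.\<close>
  have card_join: "card (A <+> B) = card A + card B"
    if "dominating_set (graph_join G H) (A <+> B)" for A B
  proof -
    from that have "A \<subseteq> pverts G" "B \<subseteq> pverts H"
      unfolding dominating_set_graph_join_iff[OF assms(3,4)] by (auto simp: dominating_set_def)
    then show ?thesis
      using assms(1,2) by (intro card_Plus) (auto intro: finite_subset)
  qed
  have "S \<in> ?L \<longleftrightarrow> S \<in> ?R" for S
  proof -
    \<comment> \<open>Any set in a sum type is the sum of its two preimages, so the criterion for
      \<open>A <+> B\<close> covers all of them.\<close>
    obtain A B where S: "S = A <+> B"
    proof
      show "S = (Inl -` S) <+> (Inr -` S)"
      proof (rule set_eqI)
        show "x \<in> S \<longleftrightarrow> x \<in> (Inl -` S) <+> (Inr -` S)" for x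
          by (cases x) auto
      qed
    qed
    have "S \<in> ?R \<longleftrightarrow> dominating_set G A \<and> card A = n \<and> B = {} \<or>
        dominating_set H B \<and> card B = n \<and> A = {} \<or>
        A \<noteq> {} \<and> B \<noteq> {} \<and> A \<subseteq> pverts G \<and> B \<subseteq> pverts H \<and> card A + card B = n"
      unfolding S by (auto simp: image_iff Plus_eq_iff)
    moreover have "S \<in> ?L \<longleftrightarrow> dominating_set (graph_join G H) S \<and> card A + card B = n"
      unfolding S mem_Collect_eq using card_join by metis
    moreover have "\<dots> \<longleftrightarrow> dominating_set G A \<and> card A = n \<and> B = {} \<or>
        dominating_set H B \<and> card B = n \<and> A = {} \<or>
        A \<noteq> {} \<and> B \<noteq> {} \<and> A \<subseteq> pverts G \<and> B \<subseteq> pverts H \<and> card A + card B = n"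
      unfolding S dominating_set_graph_join_iff[OF assms(3,4)] by auto
    ultimately show ?thesis
      by (simp only:)
  qed
  then show ?thesis
    by blast
qed

lemma dominating_count_graph_join:
  assumes "finite (pverts G)" "finite (pverts H)" "pverts G \<noteq> {}" "pverts H \<noteq> {}"
  shows "dominating_count (graph_join G H) n = dominating_count G n + dominating_count H n +
    card {(A, B). A \<noteq> {} \<and> B \<noteq> {} \<and> A \<subseteq> pverts G \<and> B \<subseteq> pverts H \<and> card A + card B = n}"
    (is "_ = _ + _ + card ?M")
proof -
  let ?DG = "{A. dominating_set G A \<and> card A = n}" and ?DH = "{B. dominating_set H B \<and> card B = n}"
  let ?l = "\<lambda>A. A <+> {} :: ('a + 'b) set" and ?r = "\<lambda>B. {} <+> B :: ('a + 'b) set"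
    and ?m = "\<lambda>(A, B). A <+> B :: ('a + 'b) set"
  have fin: "finite ?DG" "finite ?DH"
    by (rule finite_dominating_sets; fact)+
  have "finite ?M"
    using assms(1,2) by (auto intro: finite_subset[of _ "Pow (pverts G) \<times> Pow (pverts H)"])
  \<comment> \<open>The two images could share only \<open>{} <+> {}\<close>, and the empty set does
    not dominate \<open>G\<close>.\<close>
  have "?l ` ?DG \<inter> ?r ` ?DH = {}"
    using assms(3) dominating_set_nonempty by (auto simp: Plus_eq_iff)
  moreover have "(?l ` ?DG \<union> ?r ` ?DH) \<inter> ?m ` ?M = {}"
    by (auto simp: Plus_eq_iff)
  moreover have "inj_on ?l ?DG" "inj_on ?r ?DH" "inj_on ?m ?M"
    by (auto intro!: inj_onI simp: Plus_eq_iff)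
  ultimately show ?thesis
    using fin \<open>finite ?M\<close> unfolding dominating_count_def dominating_sets_graph_join[OF assms]
    by (simp add: card_Un_disjoint card_image)
qed

text \<open>A set meeting both sides has at least two elements, so the mixed term vanishes.\<close>

lemma dominating_count_graph_join_1:
  assumes "finite (pverts G)" "finite (pverts H)" "pverts G \<noteq> {}" "pverts H \<noteq> {}"
  shows "dominating_count (graph_join G H) 1 = dominating_count G 1 + dominating_count H 1"
proof -
  have "{(A, B). A \<noteq> {} \<and> B \<noteq> {} \<and> A \<subseteq> pverts G \<and> B \<subseteq> pverts H \<and> card A + card B = 1} = {}"
    using assms(1,2) by (auto simp: add_is_1 card_eq_0_iff dest: finite_subset)
  then show ?thesis
    by (simp only: dominating_count_graph_join[OF assms] card.empty add_0_right)
qed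

text \<open>Two nonempty parts of total size 2 are singletons, so mixed sets correspond to pairs of
  vertices, which gives the product.\<close>

lemma dominating_count_graph_join_2:
  assumes "finite (pverts G)" "finite (pverts H)" "pverts G \<noteq> {}" "pverts H \<noteq> {}"
  shows "dominating_count (graph_join G H) 2 =
    dominating_count G 2 + dominating_count H 2 + card (pverts G) * card (pverts H)"
proof -
  have "{(A, B). A \<noteq> {} \<and> B \<noteq> {} \<and> A \<subseteq> pverts G \<and> B \<subseteq> pverts H \<and> card A + card B = 2} =
      (\<lambda>(a, b). ({a}, {b})) ` (pverts G \<times> pverts H)" (is "?M = ?N")
  proof
    show "?M \<subseteq> ?N"
    proof clarify
      fix A B
      assume *: "A \<noteq> {}" "B \<noteq> {}" "A \<subseteq> pverts G" "B \<subseteq> pverts H" "card A + card B = 2"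
      then have "card A > 0" "card B > 0"
        using assms(1,2) by (auto simp: card_gt_0_iff dest: finite_subset)
      with * have "card A = 1" "card B = 1"
        by linarith+
      then obtain a b where "A = {a}" "B = {b}"
        by (auto simp: card_1_singleton_iff)
      with * show "(A, B) \<in> ?N"
        by auto
    qed
  qed auto
  moreover have "inj_on (\<lambda>(a, b). ({a}, {b})) (pverts G \<times> pverts H)"
    by (auto intro: inj_onI)
  ultimately show ?thesis
    by (simp add: dominating_count_graph_join[OF assms] card_image card_cartesian_product)
qed

theorem theorem3p3:
  fixes G1 :: "'a pair_pre_digraph" and G2 :: "'b pair_pre_digraph"
  assumes "pair_graph G1" and "pair_graph G2"
    and "connected (with_proj G1)" and "connected (with_proj G2)"
    and "domination_number G1 \<le> domination_number G2"
  shows "(domination_number G1 = 1 \<longrightarrow> domination_number (graph_join G1 G2) = 1)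
    \<and> (domination_number G1 \<ge> 2 \<longrightarrow> domination_number (graph_join G1 G2) = 2)
    \<and> (domination_number G1 = 1 \<and> domination_number G2 = 1 \<longrightarrow>
         dominion (graph_join G1 G2) = dominion G1 + dominion G2)
    \<and> (domination_number G1 = 2 \<and> domination_number G2 = 2 \<longrightarrow>
         dominion (graph_join G1 G2) =
           dominion G1 + dominion G2 + card (pverts G1) * card (pverts G2))
    \<and> (domination_number G1 = 1 \<and> 1 < domination_number G2 \<longrightarrow>
         dominion (graph_join G1 G2) = dominion G1)
    \<and> (domination_number G1 = 2 \<and> 2 < domination_number G2 \<longrightarrow>
         dominion (graph_join G1 G2) = dominion G1 + card (pverts G1) * card (pverts G2))
    \<and> (2 < domination_number G1 \<and> domination_number G1 \<le> domination_number G2 \<longrightarrow>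
         dominion (graph_join G1 G2) = card (pverts G1) * card (pverts G2))"
proof -
  have fin: "finite (pverts G1)" "finite (pverts G2)"
    using assms(1,2) pair_digraph.axioms(1) pair_fin_digraph.pair_finite_verts pair_graph.axioms(1)
    by blast+
  \<comment> \<open>Connectedness enters through the library's convention that a connected graph has
    a vertex.\<close>
  have ne: "pverts G1 \<noteq> {}" "pverts G2 \<noteq> {}"
    using assms(3,4) by (auto simp: connected_def strongly_connected_def)
  let ?J = "graph_join G1 G2"
  have finJ: "finite (pverts ?J)" and neJ: "pverts ?J \<noteq> {}"
    using fin ne by auto
  note c1 = dominating_count_graph_join_1[OF fin ne]
  note c2 = dominating_count_graph_join_2[OF fin ne]
  note pos = dominating_count_domination_number_pos[OF fin(1)]
    dominating_count_domination_number_pos[OF fin(2)]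
  note zero = dominating_count_eq_0[OF fin(1)] dominating_count_eq_0[OF fin(2)]
  have J1: "domination_number ?J = 1" if "domination_number G1 = 1"
    using that pos(1) dominating_count_0[OF finJ neJ]
    \<comment> \<open>The simplifier turns \<open>1\<close> into \<open>Suc 0\<close>, so
      \<open>c1\<close> is brought to that form before rewriting.\<close>
    by (intro domination_number_eqI finJ) (auto simp: c1[simplified])
  have J2: "domination_number ?J = 2" if "domination_number G1 \<ge> 2"
  proof (rule domination_number_eqI[OF finJ])
    \<comment> \<open>One vertex from each side already dominates: the product term is
      positive.\<close>
    show "dominating_count ?J 2 > 0"
      using fin ne by (simp add: c2 card_gt_0_iff)
    show "dominating_count ?J m = 0" if "m < 2" for m
      \<comment> \<open>At size 1 both summands of \<open>c1\<close> vanish, since \<open>G2\<close>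
        inherits the bound 2 from \<open>G1\<close>.\<close>
      using that \<open>domination_number G1 \<ge> 2\<close> assms(5) dominating_count_0[OF finJ neJ] c1 zero
      by (auto simp: less_2_cases_iff)
  qed
  \<comment> \<open>In each case \<open>c1\<close> or \<open>c2\<close> is read at the domination
    number of the join: a summand is the dominion of its graph if that graph has the same domination
    number, and 0 if it has a larger one.\<close>
  show ?thesis
    using J1 J2 assms(5) c1 c2 zero by (auto simp: dominion_eq_dominating_count)
qed

end
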